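(* Let $S$ be a smooth $\mathbb{R}^{n''}$-valued map defined on a neighborhood of the origin in $\mathbb{R}^{n'}\times\mathbb{R}^{n''}\times\mathbb{R}^{n'}$, let $\psi$ be a cutoff function, and let $$Tf(x',x'') = \int f(y',x''+S(x',x'',y'))\,\psi(x',x'',y')\,dy'.$$ Any such operator $T$ satisfying the homogeneity conditions with multiindices $\alpha',\alpha'',\beta',\beta''$ (defined in the context) is unbounded from $L^p(\mathbb{R}^{n})$ to $L^q(\mathbb{R}^{n})$, $n=n'+n''$, if $$\frac{|\beta'|+|\beta''|}{p}-\frac{|\alpha'|+|\beta''|}{q}>|\beta'|.$$
   Context: Fix positive integers $n',n''$. Points are $x',y'\in\mathbb{R}^{n'}$, $x''\in\mathbb{R}^{n''}$. A cutoff function here is a smooth function $\psi(x',x'',y')$ with compact support near the origin, inside the domain of $S$. A multiindex is a tuple of integers. For a multiindex $\gamma=(\gamma_1,\dots,\gamma_m)$, $z\in\mathbb{R}^m$ and an integer $j$, write $2^{j\gamma}z:=(2^{j\gamma_1}z_1,\dots,2^{j\gamma_m}z_m)$ and $|\gamma|:=\gamma_1+\cdots+\gamma_m$. Homogeneity conditions: there are multiindices $\alpha',\beta'$ of length $n'$ and $\alpha'',\beta''$ of length $n''$ such that $\beta''_i>\alpha''_i$ for all $i=1,\dots,n''$, and such that the limit $$S^P(x',x'',y'):=\lim_{j\to\infty}2^{j\beta''}S(2^{-j\alpha'}x',2^{-j\alpha''}x'',2^{-j\beta'}y')$$ exists and is a smooth function of $x',x'',y'$ which does not vanish identically.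
   Formalization: The formal theorem adds that ψ(0) ≠ 0 (ψ = 0 makes T = 0 bounded) and that all entries of α', α'', β' are nonnegative (S = y', α' = −10, α'' = 0, β' = β'' = 1, p = q = 2 is otherwise a counterexample). *)

theory Defs
  imports "HOL-Analysis.Analysis" "HOL-Probability.Essential_Supremum"
begin

text \<open>
  For open \<open>U\<close>, \<open>C_on k U f\<close> says that all iterated directional derivatives of order at most \<open>k\<close>
  exist and are continuous, every derivative of order below \<open>k\<close> being again Frechet differentiable.
  Fixing a direction \<open>v\<close> at each step keeps the type of \<open>f\<close> unchanged along the recursion.
\<close>

primrec C_on :: "nat \<Rightarrow> 'a::euclidean_space set \<Rightarrow> ('a \<Rightarrow> 'b::real_normed_vector) \<Rightarrow> bool" where
  "C_on 0 U f \<longleftrightarrow> continuous_on U f"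
| "C_on (Suc k) U f \<longleftrightarrow>
     (\<forall>x\<in>U. f differentiable (at x)) \<and> (\<forall>v. C_on k U (\<lambda>x. frechet_derivative f (at x) v))"

definition smooth_on :: "'a::euclidean_space set \<Rightarrow> ('a \<Rightarrow> 'b::real_normed_vector) \<Rightarrow> bool" where
  "smooth_on U f \<longleftrightarrow> (\<forall>k. C_on k U f)"

definition cutoff_in :: "'a::euclidean_space set \<Rightarrow> ('a \<Rightarrow> complex) \<Rightarrow> bool" where
  "cutoff_in U \<psi> \<longleftrightarrow> smooth_on UNIV \<psi> \<and>
     compact (closure {z. \<psi> z \<noteq> 0}) \<and> closure {z. \<psi> z \<noteq> 0} \<subseteq> U"

text \<open>
  Exponents \<open>p\<close> range over \<open>[1, \<infinity>]\<close>. Elements of \<open>L^p\<close> are given by Borel measurable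
  representatives.
\<close>

definition in_Lp :: "ennreal \<Rightarrow> ('a::euclidean_space \<Rightarrow> complex) \<Rightarrow> bool" where
  "in_Lp p f \<longleftrightarrow> f \<in> borel_measurable lborel \<and>
     (if p = \<infinity> then esssup lborel (\<lambda>x. ennreal (norm (f x))) < \<infinity>
      else integrable lborel (\<lambda>x. norm (f x) powr enn2real p))"

definition Lp_norm :: "ennreal \<Rightarrow> ('a::euclidean_space \<Rightarrow> complex) \<Rightarrow> real" where
  "Lp_norm p f =
     (if p = \<infinity> then enn2real (esssup lborel (\<lambda>x. ennreal (norm (f x))))
      else (\<integral>x. norm (f x) powr enn2real p \<partial>lborel) powr (1 / enn2real p))"

definition bounded_Lp_Lq ::
  "ennreal \<Rightarrow> ennreal \<Rightarrow> (('a::euclidean_space \<Rightarrow> complex) \<Rightarrow> ('b::euclidean_space \<Rightarrow> complex)) \<Rightarrow> bool"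
where
  "bounded_Lp_Lq p q T \<longleftrightarrow>
     (\<exists>C. \<forall>f. in_Lp p f \<longrightarrow> in_Lp q (T f) \<and> Lp_norm q (T f) \<le> C * Lp_norm p f)"

text \<open>
  Points \<open>(x', x'', y')\<close> are triples in \<open>(real^'m) \<times> (real^'k) \<times> (real^'m)\<close>. The map \<open>S\<close> is a total function,
  of which only the values on its domain \<open>U\<close> matter: \<open>\<psi>\<close> vanishes off \<open>U\<close>.
\<close>

definition radon_op ::
  "((real^'m) \<times> (real^'k) \<times> (real^'m) \<Rightarrow> real^'k) \<Rightarrow> ((real^'m) \<times> (real^'k) \<times> (real^'m) \<Rightarrow> complex)
     \<Rightarrow> ((real^'m) \<times> (real^'k) \<Rightarrow> complex) \<Rightarrow> ((real^'m) \<times> (real^'k) \<Rightarrow> complex)"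
where
  "radon_op S \<psi> f =
     (\<lambda>(x', x''). \<integral>y'. f (y', x'' + S (x', x'', y')) * \<psi> (x', x'', y') \<partial>lborel)"

definition mi_abs :: "int^'i \<Rightarrow> int" where
  "mi_abs \<gamma> = (\<Sum>i\<in>UNIV. \<gamma> $ i)"

definition dil :: "int \<Rightarrow> int^'i \<Rightarrow> real^'i \<Rightarrow> real^'i" where
  "dil j \<gamma> z = (\<chi> i. 2 powi (j * \<gamma> $ i) * z $ i)"

text \<open>
  As \<open>S\<close> is only given near the origin, the dilations inside \<open>S\<close> must not expand, which is the sign
  condition below. Strictly positive entries allow \<open>W = UNIV\<close>; if some entries are \<open>0\<close>, the
  limit makes sense on a neighbourhood \<open>W\<close> of the origin only.
\<close>

definition homogeneity_conditions ::
  "((real^'m) \<times> (real^'k) \<times> (real^'m)) set \<Rightarrow> ((real^'m) \<times> (real^'k) \<times> (real^'m) \<Rightarrow> real^'k)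
     \<Rightarrow> int^'m \<Rightarrow> int^'k \<Rightarrow> int^'m \<Rightarrow> int^'k \<Rightarrow> bool"
where
  "homogeneity_conditions U S \<alpha>' \<alpha>'' \<beta>' \<beta>'' \<longleftrightarrow>
     (\<forall>i. 0 \<le> \<alpha>' $ i) \<and> (\<forall>i. 0 \<le> \<alpha>'' $ i) \<and> (\<forall>i. 0 \<le> \<beta>' $ i) \<and>
     (\<forall>i. \<beta>'' $ i > \<alpha>'' $ i) \<and>
     (\<exists>W SP. open W \<and> 0 \<in> W \<and>
        (\<forall>x' x'' y'. (x', x'', y') \<in> W \<longrightarrow>
           (\<forall>\<^sub>F j in sequentially.
              (dil (- int j) \<alpha>' x', dil (- int j) \<alpha>'' x'', dil (- int j) \<beta>' y') \<in> U) \<and>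
           (\<lambda>j. dil (int j) \<beta>''
                  (S (dil (- int j) \<alpha>' x', dil (- int j) \<alpha>'' x'', dil (- int j) \<beta>' y')))
             \<longlonglongrightarrow> SP (x', x'', y')) \<and>
        smooth_on W SP \<and> (\<exists>z\<in>W. SP z \<noteq> 0))"

end

theory Submission
  imports Defs
begin

text \<open>
  For \<open>z\<close> in a small cube \<open>Q\<close> let \<open>h z t\<close> be the \<open>i\<close>-th component of \<open>S\<close> at the point with coordinates
  dilated by the powers \<open>\<alpha>', \<alpha>'', \<beta>'\<close> of \<open>t\<close>. This is smooth in \<open>t \<in> [0, 1]\<close> because these exponents are
  nonnegative integers. Convergence at each single \<open>z\<close> gives \<open>h z (2 ^ -j) = O(2 ^ (-j \<beta>''_i))\<close>, so the Taylor
  coefficients of order below \<open>\<beta>''_i\<close> vanish, and the remainder yields \<open>\<bar>h z t\<bar> \<le> M t ^ \<beta>''_i\<close> uniformly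
  in \<open>z \<in> Q\<close>.

  Now test \<open>T\<close> on the indicator of the box with sides \<open>\<sim> t ^ \<beta>'\<close> and \<open>\<sim> t ^ \<beta>''\<close>. If \<open>x'\<close> and \<open>x''\<close> lie in boxes
  with sides \<open>\<sim> t ^ \<alpha>'\<close> and \<open>\<sim> t ^ \<beta>''\<close> (the latter is contained in the \<open>t ^ \<alpha>''\<close> box), the argument
  \<open>x'' + S\<close> stays in the second factor, so \<open>\<bar>T f\<bar> \<ge> c t ^ \<bar>\<beta>'\<bar>\<close> there. Boundedness would
  force \<open>t powr (\<bar>\<beta>'\<bar> + (\<bar>\<alpha>'\<bar> + \<bar>\<beta>''\<bar>) / q) \<le> C t powr ((\<bar>\<beta>'\<bar> + \<bar>\<beta>''\<bar>) / p)\<close> as \<open>t\<close> tends to \<open>0\<close>.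
\<close>

section \<open>Uniformly bounded derivatives along curves\<close>

text \<open>Each derivative is an existential witness of the same type as \<open>u\<close>, which
  keeps the recursion within one type. The bounds are uniform over the parameter set
  \<open>Q\<close>, and derivatives at the ends of \<open>{0..1}\<close> are one-sided, so that
  Taylor expansion at t = 0 is available.\<close>

primrec bounded_derivs :: "nat \<Rightarrow> 'c set \<Rightarrow> (real \<Rightarrow> 'c \<Rightarrow> 'b::real_normed_vector) \<Rightarrow> bool" where
  "bounded_derivs 0 Q u \<longleftrightarrow> (\<exists>B. \<forall>t\<in>{0..1}. \<forall>z\<in>Q. norm (u t z) \<le> B)"
| "bounded_derivs (Suc n) Q u \<longleftrightarrow> (\<exists>B. \<forall>t\<in>{0..1}. \<forall>z\<in>Q. norm (u t z) \<le> B) \<and>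
     (\<exists>u'. (\<forall>t\<in>{0..1}. \<forall>z\<in>Q. ((\<lambda>s. u s z) has_vector_derivative u' t z) (at t within {0..1})) \<and>
           bounded_derivs n Q u')"

lemma bounded_derivs_0I:
  assumes "\<And>t z. t \<in> {0..1} \<Longrightarrow> z \<in> Q \<Longrightarrow> norm (u t z) \<le> B"
  shows "bounded_derivs 0 Q u"
  using assms unfolding bounded_derivs.simps by blast

lemma bounded_derivs_bound:
  assumes "bounded_derivs n Q u"
  obtains B where "\<And>t z. t \<in> {0..1} \<Longrightarrow> z \<in> Q \<Longrightarrow> norm (u t z) \<le> B"
proof -
  have "\<exists>B. \<forall>t\<in>{0..1}. \<forall>z\<in>Q. norm (u t z) \<le> B"
    using assms by (cases n) auto
  then show thesis
    using that by blast
qed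

lemma bounded_derivs_SucI:
  assumes "bounded_derivs 0 Q u" and "bounded_derivs n Q u'"
    and "\<And>t z. t \<in> {0..1} \<Longrightarrow> z \<in> Q \<Longrightarrow>
      ((\<lambda>s. u s z) has_vector_derivative u' t z) (at t within {0..1})"
  shows "bounded_derivs (Suc n) Q u"
  unfolding bounded_derivs.simps
proof (intro conjI exI[of _ u'] ballI)
  show "\<exists>B. \<forall>t\<in>{0..1}. \<forall>z\<in>Q. norm (u t z) \<le> B"
    using assms(1) by simp
qed (use assms in auto)

lemma bounded_derivs_SucE:
  assumes "bounded_derivs (Suc n) Q u"
  obtains u' where "bounded_derivs 0 Q u" "bounded_derivs n Q u'"
    "\<And>t z. t \<in> {0..1} \<Longrightarrow> z \<in> Q \<Longrightarrow>
      ((\<lambda>s. u s z) has_vector_derivative u' t z) (at t within {0..1})"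
  using assms unfolding bounded_derivs.simps by blast

lemma bounded_derivs_SucD: "bounded_derivs (Suc n) Q u \<Longrightarrow> bounded_derivs n Q u"
proof (induction n arbitrary: u)
  case (Suc n)
  from Suc.prems show ?case
    by (rule bounded_derivs_SucE) (rule bounded_derivs_SucI, assumption, rule Suc.IH)
qed simp

lemma bounded_derivs_linear:
  fixes u :: "real \<Rightarrow> 'c \<Rightarrow> 'a::real_normed_vector" and L :: "'a \<Rightarrow> 'b::real_normed_vector"
  assumes L: "bounded_linear L" and "bounded_derivs n Q u"
  shows "bounded_derivs n Q (\<lambda>t z. L (u t z))"
proof -
  have base: "bounded_derivs 0 Q (\<lambda>t z. L (u t z))"
    if u: "bounded_derivs 0 Q u" for u :: "real \<Rightarrow> 'c \<Rightarrow> 'a"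
  proof -
    obtain K where K: "K > 0" "\<And>x. norm (L x) \<le> norm x * K"
      using bounded_linear.pos_bounded[OF L] by blast
    obtain B where "\<And>t z. t \<in> {0..1} \<Longrightarrow> z \<in> Q \<Longrightarrow> norm (u t z) \<le> B"
      using bounded_derivs_bound[OF u] by metis
    then have "norm (L (u t z)) \<le> B * K" if "t \<in> {0..1}" "z \<in> Q" for t z
      using K that by (meson order_trans mult_right_mono less_imp_le)
    then show ?thesis by (rule bounded_derivs_0I)
  qed
  show ?thesis
    using assms(2)
  proof (induction n arbitrary: u)
    case (Suc n)
    from Suc.prems show ?case
    proof (rule bounded_derivs_SucE)
      fix u' assume u': "bounded_derivs 0 Q u" "bounded_derivs n Q u'"
        "\<And>t z. t \<in> {0..1} \<Longrightarrow> z \<in> Q \<Longrightarrow>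
          ((\<lambda>s. u s z) has_vector_derivative u' t z) (at t within {0..1})"
      show ?case
        by (rule bounded_derivs_SucI[OF base[OF u'(1)] Suc.IH[OF u'(2)]])
          (intro bounded_linear.has_vector_derivative[OF L] u')
    qed
  qed (rule base)
qed

lemma bounded_derivs_add:
  fixes u v :: "real \<Rightarrow> 'a \<Rightarrow> 'b::real_normed_vector"
  assumes "bounded_derivs n Q u" and "bounded_derivs n Q v"
  shows "bounded_derivs n Q (\<lambda>t z. u t z + v t z)"
proof -
  have base: "bounded_derivs 0 Q (\<lambda>t z. u t z + v t z)"
    if u: "bounded_derivs 0 Q u" and v: "bounded_derivs 0 Q v" for u v :: "real \<Rightarrow> 'a \<Rightarrow> 'b"
  proof -
    obtain B where B: "\<And>t z. t \<in> {0..1} \<Longrightarrow> z \<in> Q \<Longrightarrow> norm (u t z) \<le> B"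
      using bounded_derivs_bound[OF u] by metis
    obtain B' where B': "\<And>t z. t \<in> {0..1} \<Longrightarrow> z \<in> Q \<Longrightarrow> norm (v t z) \<le> B'"
      using bounded_derivs_bound[OF v] by metis
    show ?thesis
      by (rule bounded_derivs_0I[where B = "B + B'"]) (intro norm_triangle_mono B B')
  qed
  show ?thesis
    using assms
  proof (induction n arbitrary: u v)
    case (Suc n)
    obtain u' where u': "bounded_derivs 0 Q u" "bounded_derivs n Q u'"
      "\<And>t z. t \<in> {0..1} \<Longrightarrow> z \<in> Q \<Longrightarrow>
        ((\<lambda>s. u s z) has_vector_derivative u' t z) (at t within {0..1})"
      using bounded_derivs_SucE[OF Suc.prems(1)] by metis
    obtain v' where v': "bounded_derivs 0 Q v" "bounded_derivs n Q v'"
      "\<And>t z. t \<in> {0..1} \<Longrightarrow> z \<in> Q \<Longrightarrow>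
        ((\<lambda>s. v s z) has_vector_derivative v' t z) (at t within {0..1})"
      using bounded_derivs_SucE[OF Suc.prems(2)] by metis
    show ?case
      by (rule bounded_derivs_SucI[OF base[OF u'(1) v'(1)] Suc.IH[OF u'(2) v'(2)]])
        (intro has_vector_derivative_add u' v')
  qed (rule base)
qed

lemma bounded_derivs_bilinear:
  fixes u :: "real \<Rightarrow> 'a \<Rightarrow> 'b::real_normed_vector" and v :: "real \<Rightarrow> 'a \<Rightarrow> 'c::real_normed_vector"
    and P :: "'b \<Rightarrow> 'c \<Rightarrow> 'd::real_normed_vector"
  assumes P: "bounded_bilinear P" and "bounded_derivs n Q u" and "bounded_derivs n Q v"
  shows "bounded_derivs n Q (\<lambda>t z. P (u t z) (v t z))"
proof -
  have base: "bounded_derivs 0 Q (\<lambda>t z. P (u t z) (v t z))"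
    if u: "bounded_derivs 0 Q u" and v: "bounded_derivs 0 Q v"
    for u :: "real \<Rightarrow> 'a \<Rightarrow> 'b" and v :: "real \<Rightarrow> 'a \<Rightarrow> 'c"
  proof -
    obtain K where K: "K > 0" "\<And>x y. norm (P x y) \<le> norm x * norm y * K"
      using bounded_bilinear.pos_bounded[OF P] by blast
    obtain B where B: "\<And>t z. t \<in> {0..1} \<Longrightarrow> z \<in> Q \<Longrightarrow> norm (u t z) \<le> B"
      using bounded_derivs_bound[OF u] by metis
    obtain B' where B': "\<And>t z. t \<in> {0..1} \<Longrightarrow> z \<in> Q \<Longrightarrow> norm (v t z) \<le> B'"
      using bounded_derivs_bound[OF v] by metis
    have "norm (P (u t z) (v t z)) \<le> \<bar>B\<bar> * \<bar>B'\<bar> * K" if "t \<in> {0..1}" "z \<in> Q" for t z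
    proof -
      have "norm (u t z) \<le> \<bar>B\<bar>" "norm (v t z) \<le> \<bar>B'\<bar>"
        using B[OF that] B'[OF that] by linarith+
      then have "norm (u t z) * norm (v t z) * K \<le> \<bar>B\<bar> * \<bar>B'\<bar> * K"
        using K(1) by (intro mult_mono) auto
      with K(2) show ?thesis by (rule order_trans)
    qed
    then show ?thesis by (rule bounded_derivs_0I)
  qed
  show ?thesis
    using assms(2,3)
  proof (induction n arbitrary: u v)
    case (Suc n)
    obtain u' where u': "bounded_derivs 0 Q u" "bounded_derivs n Q u'"
      "\<And>t z. t \<in> {0..1} \<Longrightarrow> z \<in> Q \<Longrightarrow>
        ((\<lambda>s. u s z) has_vector_derivative u' t z) (at t within {0..1})"
      using bounded_derivs_SucE[OF Suc.prems(1)] by metis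
    obtain v' where v': "bounded_derivs 0 Q v" "bounded_derivs n Q v'"
      "\<And>t z. t \<in> {0..1} \<Longrightarrow> z \<in> Q \<Longrightarrow>
        ((\<lambda>s. v s z) has_vector_derivative v' t z) (at t within {0..1})"
      using bounded_derivs_SucE[OF Suc.prems(2)] by metis
    \<comment> \<open>Leibniz rule: in each summand one factor is a derivative with n bounded
      orders, and the other is an original factor from which one order is dropped.\<close>
    have "bounded_derivs n Q (\<lambda>t z. P (u t z) (v' t z) + P (u' t z) (v t z))"
      by (rule bounded_derivs_add; rule Suc.IH)
        (rule u' v' bounded_derivs_SucD[OF Suc.prems(1)] bounded_derivs_SucD[OF Suc.prems(2)])+
    then show ?case
      by (rule bounded_derivs_SucI[OF base[OF u'(1) v'(1)]])
        (intro bounded_bilinear.has_vector_derivative[OF P] u' v')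
  qed (rule base)
qed

lemma bounded_derivs_const:
  fixes c :: "'c \<Rightarrow> 'b::real_normed_vector"
  assumes "\<And>z. z \<in> Q \<Longrightarrow> norm (c z) \<le> B"
  shows "bounded_derivs n Q (\<lambda>t z. c z)"
proof -
  have zero: "bounded_derivs n Q (\<lambda>t z. 0::'b)" for n
  proof (induction n)
    case 0
    show ?case by (rule bounded_derivs_0I[where B = 0]) simp
  next
    case (Suc n)
    show ?case
      by (rule bounded_derivs_SucI[OF _ Suc])
        (auto intro: bounded_derivs_0I[where B = 0] has_vector_derivative_const)
  qed
  have base: "bounded_derivs 0 Q (\<lambda>t z. c z)"
    by (rule bounded_derivs_0I) (rule assms)
  show ?thesis
  proof (cases n)
    case (Suc m)
    show ?thesis
      unfolding Suc by (rule bounded_derivs_SucI[OF base zero]) (rule has_vector_derivative_const)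
  qed (use base in simp)
qed

lemma bounded_derivs_sum:
  assumes "\<And>i. i \<in> I \<Longrightarrow> bounded_derivs n Q (u i)"
  shows "bounded_derivs n Q (\<lambda>t z. \<Sum>i\<in>I. u i t z)"
  using assms
  by (induction I rule: infinite_finite_induct)
     (auto intro: bounded_derivs_add bounded_derivs_const[where B = 0])

lemma bounded_derivs_power: "bounded_derivs n Q (\<lambda>t z. t ^ m)"
proof -
  have id: "bounded_derivs n Q (\<lambda>t z. t)"
  proof (cases n)
    case 0
    show ?thesis
      unfolding 0 by (rule bounded_derivs_0I[where B = 1]) auto
  next
    case (Suc n')
    have bd: "bounded_derivs 0 Q (\<lambda>t z. t)"
      by (rule bounded_derivs_0I[where B = 1]) auto
    have "bounded_derivs n' Q (\<lambda>t z. 1::real)"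
      by (rule bounded_derivs_const[where B = 1]) simp
    then show ?thesis
      unfolding Suc by (rule bounded_derivs_SucI[OF bd]) (rule has_vector_derivative_id)
  qed
  show ?thesis
  proof (induction m)
    case 0
    show ?case by (simp add: bounded_derivs_const[where B = 1])
  next
    case (Suc m)
    show ?case
      using bounded_derivs_bilinear[OF bounded_bilinear_mult id Suc] by simp
  qed
qed

text \<open>Chain rule by induction on the order, with \<open>g\<close> varying and the curves
  fixed. A compact set containing all curves turns continuity of the derivatives of \<open>g\<close>
  into bounds uniform in the parameter.\<close>

lemma bounded_derivs_compose:
  fixes g :: "'a::euclidean_space \<Rightarrow> 'b::real_normed_vector"
  assumes "C_on n U g" "bounded_derivs n Q \<delta>"
    and K: "compact K" "K \<subseteq> U" and in_K: "\<And>t z. t \<in> {0..1} \<Longrightarrow> z \<in> Q \<Longrightarrow> \<delta> t z \<in> K"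
  shows "bounded_derivs n Q (\<lambda>t z. g (\<delta> t z))"
  using assms(1,2)
proof (induction n arbitrary: g)
  case (0 g)
  have "compact (g ` K)"
    using 0 K by (auto intro: compact_continuous_image continuous_on_subset)
  then obtain B where "\<forall>y\<in>g ` K. norm y \<le> B"
    by (meson compact_imp_bounded bounded_iff)
  then show ?case
    using in_K by (intro bounded_derivs_0I[where B = B]) auto
next
  case (Suc n g)
  obtain \<delta>' where \<delta>': "bounded_derivs n Q \<delta>'"
    "\<And>t z. t \<in> {0..1} \<Longrightarrow> z \<in> Q \<Longrightarrow>
      ((\<lambda>s. \<delta> s z) has_vector_derivative \<delta>' t z) (at t within {0..1})"
    using bounded_derivs_SucE[OF Suc.prems(2)] by metis
  \<comment> \<open>Expanding the velocity over \<open>Basis\<close> leaves only derivatives of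
    \<open>g\<close> in fixed directions; these are the functions that the recursion of
    \<open>C_on\<close> controls, so the induction hypothesis applies to them.\<close>
  define u' where "u' t z = (\<Sum>b\<in>Basis. (\<delta>' t z \<bullet> b) *\<^sub>R frechet_derivative g (at (\<delta> t z)) b)" for t z
  have "bounded_derivs n Q u'"
    unfolding u'_def
  proof (intro bounded_derivs_sum bounded_derivs_bilinear[OF bounded_bilinear_scaleR])
    show "bounded_derivs n Q (\<lambda>t z. \<delta>' t z \<bullet> b)" for b
      by (rule bounded_derivs_linear[OF bounded_linear_inner_left \<delta>'(1)])
    show "bounded_derivs n Q (\<lambda>t z. frechet_derivative g (at (\<delta> t z)) b)" for b
      using Suc.prems(1) by (intro Suc.IH bounded_derivs_SucD[OF Suc.prems(2)]) auto
  qed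
  moreover have "bounded_derivs 0 Q (\<lambda>t z. g (\<delta> t z))"
  proof -
    have "continuous_on K g"
      using Suc.prems(1) K(2)
      by (auto intro!: continuous_at_imp_continuous_on differentiable_imp_continuous_within)
    then obtain B where "\<forall>y\<in>g ` K. norm y \<le> B"
      using K(1) by (meson compact_continuous_image compact_imp_bounded bounded_iff)
    then show ?thesis
      using in_K by (intro bounded_derivs_0I[where B = B]) auto
  qed
  moreover have "((\<lambda>s. g (\<delta> s z)) has_vector_derivative u' t z) (at t within {0..1})"
    if tz: "t \<in> {0..1}" "z \<in> Q" for t z
  proof -
    let ?D = "frechet_derivative g (at (\<delta> t z))"
    have "g differentiable at (\<delta> t z)"
      using Suc.prems(1) in_K[OF tz] K(2) by auto
    then have D: "(g has_derivative ?D) (at (\<delta> t z))"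
      by (simp add: frechet_derivative_works)
    have "u' t z = ?D (\<Sum>b\<in>Basis. (\<delta>' t z \<bullet> b) *\<^sub>R b)"
      unfolding u'_def using has_derivative_linear[OF D] by (simp add: linear_sum linear_scale)
    also have "\<dots> = ?D (\<delta>' t z)"
      by (simp add: euclidean_representation)
    finally show ?thesis
      using vector_derivative_diff_chain_within[OF \<delta>'(2)[OF tz] has_derivative_at_withinI[OF D]]
      by (simp add: o_def)
  qed
  ultimately show ?case
    by (intro bounded_derivs_SucI[where u' = u'])
qed

section \<open>Pointwise decay is uniform\<close>

text \<open>A polynomial of degree below N that is O(t ^ N) along a positive null sequence vanishes:
  the limit removes the constant term, then dividing by \<open>t j\<close> lowers N by one and
  shifts the coefficients.\<close>

lemma coeffs_zero_if_small:
  fixes c :: "nat \<Rightarrow> real" and t :: "nat \<Rightarrow> real"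
  assumes t: "t \<longlonglongrightarrow> 0" "\<And>j. t j > 0"
    and "\<And>j. \<bar>\<Sum>i<N. c i * t j ^ i\<bar> \<le> C * t j ^ N" and "i < N"
  shows "c i = 0"
  using assms(3,4)
proof (induction N arbitrary: c i)
  case (Suc N)
  have "(\<lambda>j. \<Sum>i<Suc N. c i * t j ^ i) \<longlonglongrightarrow> (\<Sum>i<Suc N. c i * 0 ^ i)"
    by (intro tendsto_sum tendsto_mult tendsto_power tendsto_const t(1))
  have "(\<lambda>j. C * t j ^ Suc N) \<longlonglongrightarrow> C * 0 ^ Suc N"
    by (intro tendsto_sum tendsto_mult tendsto_power tendsto_const t(1))
  then have "(\<lambda>j. C * t j ^ Suc N) \<longlonglongrightarrow> 0"
    by simp
  then have "(\<lambda>j. \<Sum>i<Suc N. c i * t j ^ i) \<longlonglongrightarrow> 0"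
    by (rule Lim_null_comparison[rotated]) (simp only: real_norm_def Suc.prems(1) eventually_True)
  with \<open>(\<lambda>j. \<Sum>i<Suc N. c i * t j ^ i) \<longlonglongrightarrow> (\<Sum>i<Suc N. c i * 0 ^ i)\<close>
  have "(\<Sum>i<Suc N. c i * 0 ^ i) = 0"
    by (rule LIMSEQ_unique)
  \<comment> \<open>Since \<open>0 ^ 0 = 1\<close>, the value of the polynomial at 0 is
    \<open>c 0\<close>.\<close>
  then have c0: "c 0 = 0"
    unfolding sum.lessThan_Suc_shift by simp
  have "\<bar>\<Sum>i<N. c (Suc i) * t j ^ i\<bar> \<le> C * t j ^ N" for j
  proof -
    have "(\<Sum>i<Suc N. c i * t j ^ i) = t j * (\<Sum>i<N. c (Suc i) * t j ^ i)"
      unfolding sum.lessThan_Suc_shift c0 sum_distrib_left by (simp add: mult_ac)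
    then have "t j * \<bar>\<Sum>i<N. c (Suc i) * t j ^ i\<bar> \<le> t j * (C * t j ^ N)"
      using Suc.prems(1)[of j] t(2)[of j] by (simp add: abs_mult mult.left_commute del: sum.lessThan_Suc)
    then show ?thesis
      using t(2)[of j] by simp
  qed
  note IH = Suc.IH[OF this]
  show ?case
  proof (cases i)
    case (Suc i')
    with \<open>i < Suc N\<close> IH[of i'] show ?thesis by simp
  qed (simp add: c0)
qed simp

text \<open>The nested witnesses become one indexed family of derivatives, the shape that
  \<open>field_Taylor\<close> expects; the bound on the last member controls the remainder.\<close>

lemma bounded_derivs_sequence:
  fixes u :: "real \<Rightarrow> 'c \<Rightarrow> real"
  assumes "bounded_derivs n Q u"
  obtains H B where "H 0 = u"
    "\<And>i t z. i < n \<Longrightarrow> t \<in> {0..1} \<Longrightarrow> z \<in> Q \<Longrightarrow>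
        ((\<lambda>s. H i s z) has_field_derivative H (Suc i) t z) (at t within {0..1})"
    "\<And>t z. t \<in> {0..1} \<Longrightarrow> z \<in> Q \<Longrightarrow> norm (H n t z) \<le> B"
proof -
  have "\<exists>H B. H 0 = u \<and>
    (\<forall>i<n. \<forall>t\<in>{0..1}. \<forall>z\<in>Q. ((\<lambda>s. H i s z) has_field_derivative H (Suc i) t z) (at t within {0..1})) \<and>
    (\<forall>t\<in>{0..1}. \<forall>z\<in>Q. norm (H n t z) \<le> B)"
    using assms
  proof (induction n arbitrary: u)
    case 0
    then obtain B where "\<forall>t\<in>{0..1}. \<forall>z\<in>Q. norm (u t z) \<le> B" by auto
    then show ?case by (intro exI[of _ "\<lambda>_. u"] exI[of _ B]) auto
  next
    case (Suc n)
    obtain u' where u': "bounded_derivs n Q u'"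
      "\<And>t z. t \<in> {0..1} \<Longrightarrow> z \<in> Q \<Longrightarrow>
        ((\<lambda>s. u s z) has_vector_derivative u' t z) (at t within {0..1})"
      using bounded_derivs_SucE[OF Suc.prems] by metis
    from Suc.IH[OF u'(1)] obtain H B where H: "H 0 = u'"
      "\<forall>i<n. \<forall>t\<in>{0..1}. \<forall>z\<in>Q. ((\<lambda>s. H i s z) has_field_derivative H (Suc i) t z) (at t within {0..1})"
      "\<forall>t\<in>{0..1}. \<forall>z\<in>Q. norm (H n t z) \<le> B"
      by blast
    show ?case
    proof (intro exI[of _ "case_nat u H"] exI[of _ B] conjI allI impI)
      fix i assume "i < Suc n"
      then show "\<forall>t\<in>{0..1}. \<forall>z\<in>Q. ((\<lambda>s. case_nat u H i s z) has_field_derivative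
          case_nat u H (Suc i) t z) (at t within {0..1})"
        using H u'(2) by (cases i) (auto simp: has_real_derivative_iff_has_vector_derivative)
    qed (use H in auto)
  qed
  then show thesis using that by blast
qed

text \<open>The decay constant may depend on z, but it serves only to annihilate the Taylor
  coefficients at 0. What remains is the remainder, whose constant \<open>B / fact n\<close> is the
  same for all z.\<close>

lemma pointwise_decay_imp_uniform:
  fixes u :: "real \<Rightarrow> 'c \<Rightarrow> real"
  assumes u: "bounded_derivs N Q u"
    and decay: "\<And>z. z \<in> Q \<Longrightarrow> \<exists>C. \<forall>j. \<bar>u ((1/2) ^ j) z\<bar> \<le> C * ((1/2) ^ j) ^ N"
  obtains M where "\<And>t z. t \<in> {0..1} \<Longrightarrow> z \<in> Q \<Longrightarrow> \<bar>u t z\<bar> \<le> M * t ^ N"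
proof (cases N)
  case 0
  obtain B where "\<And>t z. t \<in> {0..1} \<Longrightarrow> z \<in> Q \<Longrightarrow> norm (u t z) \<le> B"
    using bounded_derivs_bound[OF u] by metis
  then show thesis
    using that[of B] 0 by simp
next
  case (Suc n)
  from bounded_derivs_sequence[OF u] obtain H B where H: "H 0 = u"
    "\<And>i t z. i < N \<Longrightarrow> t \<in> {0..1} \<Longrightarrow> z \<in> Q \<Longrightarrow>
        ((\<lambda>s. H i s z) has_field_derivative H (Suc i) t z) (at t within {0..1})"
    "\<And>t z. t \<in> {0..1} \<Longrightarrow> z \<in> Q \<Longrightarrow> norm (H N t z) \<le> B"
    by blast
  \<comment> \<open>Expansion up to degree n = N - 1; \<open>field_Taylor\<close> bounds the
    remainder with \<open>fact n\<close>, not with \<open>fact N\<close>.\<close>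
  have taylor: "\<bar>u t z - (\<Sum>i<N. H i 0 z / fact i * t ^ i)\<bar> \<le> B / fact n * t ^ N"
    if "t \<in> {0..1}" "z \<in> Q" for t z
    using field_Taylor[of "{0..1}" n "\<lambda>i s. H i s z" B 0 t] H that Suc
    by (simp add: lessThan_Suc_atMost)
  have "\<bar>u t z\<bar> \<le> B / fact n * t ^ N" if tz: "t \<in> {0..1}" "z \<in> Q" for t z
  proof -
    obtain C where C: "\<And>j. \<bar>u ((1/2) ^ j) z\<bar> \<le> C * ((1/2) ^ j) ^ N"
      using decay[OF tz(2)] by blast
    have "H i 0 z / fact i = 0" if "i < N" for i
    \<comment> \<open>The Taylor polynomial is at most the function, bounded by C, plus the
      remainder, bounded by \<open>B / fact n\<close>, each times the N-th power.\<close>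
    proof (rule coeffs_zero_if_small[where t = "\<lambda>j. (1/2) ^ j" and C = "C + B / fact n"])
      show "(\<lambda>j. (1/2::real) ^ j) \<longlonglongrightarrow> 0"
        by (rule LIMSEQ_power_zero) simp
      show "\<bar>\<Sum>i<N. H i 0 z / fact i * ((1/2) ^ j) ^ i\<bar> \<le> (C + B / fact n) * ((1/2) ^ j) ^ N" for j
        using taylor[of "(1/2) ^ j" z] C[of j] tz(2)
        by (simp add: power_le_one distrib_right)
    qed (use that in auto)
    then show ?thesis
      using taylor[OF tz] by simp
  qed
  then show thesis by (rule that)
qed

lemma bounded_derivs_Pair:
  fixes u :: "real \<Rightarrow> 'a \<Rightarrow> 'b::real_normed_vector" and v :: "real \<Rightarrow> 'a \<Rightarrow> 'c::real_normed_vector"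
  assumes "bounded_derivs n Q u" and "bounded_derivs n Q v"
  shows "bounded_derivs n Q (\<lambda>t z. (u t z, v t z))"
proof -
  have "bounded_derivs n Q (\<lambda>t z. (u t z, 0::'c))"
    by (rule bounded_derivs_linear[OF _ assms(1)])
      (intro bounded_linear_Pair bounded_linear_ident bounded_linear_zero)
  moreover have "bounded_derivs n Q (\<lambda>t z. (0::'b, v t z))"
    by (rule bounded_derivs_linear[OF _ assms(2)])
      (intro bounded_linear_Pair bounded_linear_ident bounded_linear_zero)
  ultimately have "bounded_derivs n Q (\<lambda>t z. (u t z, 0) + (0, v t z))"
    by (rule bounded_derivs_add)
  then show ?thesis by simp
qed

section \<open>Anisotropic dilations and boxes\<close>

text \<open>A counterpart of \<open>dil\<close> with a real parameter: natural exponents make it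
  polynomial in t, hence smooth up to t = 0. For nonnegative weights it agrees with
  \<open>dil (- int j)\<close> at t = 2 ^ -j.\<close>

definition scaling :: "real \<Rightarrow> int^'i \<Rightarrow> real^'i \<Rightarrow> real^'i" where
  "scaling t \<gamma> z = (\<chi> i. t ^ nat (\<gamma> $ i) * z $ i)"

lemma abs_scaling_le:
  assumes "0 \<le> t" and "t \<le> 1" and "\<bar>v $ i\<bar> \<le> r"
  shows "\<bar>scaling t \<gamma> v $ i\<bar> \<le> r"
proof -
  have "t ^ nat (\<gamma> $ i) * \<bar>v $ i\<bar> \<le> 1 * r"
    using assms by (intro mult_mono) (simp_all add: power_le_one)
  then show ?thesis
    using assms(1) by (simp add: scaling_def abs_mult)
qed

lemma dil_neg_eq_scaling:
  assumes "\<And>i. 0 \<le> \<gamma> $ i"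
  shows "dil (- int j) \<gamma> z = scaling ((1/2) ^ j) \<gamma> z"
proof -
  have "(2::real) powi (- int j * \<gamma> $ i) = ((1/2) ^ j) ^ nat (\<gamma> $ i)" for i :: 'a
  proof -
    have "(2::real) powi (- int j * \<gamma> $ i) = 2 powi (- int (j * nat (\<gamma> $ i)))"
      using assms[of i] by simp
    also have "\<dots> = inverse (2 ^ (j * nat (\<gamma> $ i)))"
      by (simp only: power_int_minus power_int_of_nat)
    also have "\<dots> = ((1/2) ^ j) ^ nat (\<gamma> $ i)"
      by (simp add: power_mult power_divide inverse_eq_divide)
    finally show ?thesis .
  qed
  then show ?thesis
    by (simp add: dil_def scaling_def vec_eq_iff)
qed

lemma bounded_derivs_scaling:
  fixes h :: "'c \<Rightarrow> real^'i"
  assumes "\<And>z i. z \<in> Q \<Longrightarrow> \<bar>h z $ i\<bar> \<le> r"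
  shows "bounded_derivs n Q (\<lambda>t z. scaling t \<gamma> (h z))"
proof -
  have "scaling t \<gamma> (h z) = (\<Sum>i\<in>UNIV. (t ^ nat (\<gamma> $ i) * h z $ i) *\<^sub>R axis i 1)" for t z
    by (simp add: scaling_def vec_eq_iff axis_def if_distrib cong: if_cong)
  moreover have "bounded_derivs n Q (\<lambda>t z. \<Sum>i\<in>UNIV. (t ^ nat (\<gamma> $ i) * h z $ i) *\<^sub>R axis i (1::real))"
    by (intro bounded_derivs_sum bounded_derivs_linear[OF bounded_linear_scaleR_left]
        bounded_derivs_bilinear[OF bounded_bilinear_mult] bounded_derivs_power
        bounded_derivs_const[where B = r]) (simp add: assms)
  ultimately show ?thesis by simp
qed

text \<open>Stated as a \<open>cbox\<close> so that compactness and volume formulas apply directly;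
  for t > 0 its points are also scaled points of the cube of half-side r.\<close>

definition weighted_box :: "real \<Rightarrow> real \<Rightarrow> int^'i \<Rightarrow> (real^'i) set" where
  "weighted_box r t \<gamma> = cbox (- (\<chi> i. r * t ^ nat (\<gamma> $ i))) (\<chi> i. r * t ^ nat (\<gamma> $ i))"

lemma mem_weighted_box: "x \<in> weighted_box r t \<gamma> \<longleftrightarrow> (\<forall>i. \<bar>x $ i\<bar> \<le> r * t ^ nat (\<gamma> $ i))"
  by (auto simp: weighted_box_def mem_box_cart abs_le_iff minus_le_iff)

lemma weighted_box_eq_scaling:
  assumes "x \<in> weighted_box r t \<gamma>" and "0 < t"
  obtains z where "x = scaling t \<gamma> z" and "\<And>i. \<bar>z $ i\<bar> \<le> r"
proof
  show "x = scaling t \<gamma> (\<chi> i. x $ i / t ^ nat (\<gamma> $ i))"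
    using assms(2) by (simp add: scaling_def vec_eq_iff)
  show "\<bar>(\<chi> i. x $ i / t ^ nat (\<gamma> $ i)) $ i\<bar> \<le> r" for i
    using assms by (simp add: mem_weighted_box abs_divide pos_divide_le_eq)
qed

lemma measure_weighted_box:
  fixes \<gamma> :: "int^'i"
  assumes "0 \<le> r" and "0 < t" and "\<And>i. 0 \<le> \<gamma> $ i"
  shows "measure lborel (weighted_box r t \<gamma>) = (2 * r) ^ CARD('i) * t powr mi_abs \<gamma>"
proof -
  have "0 \<in> weighted_box r t \<gamma>"
    using assms by (simp add: mem_weighted_box)
  then have "measure lborel (weighted_box r t \<gamma>) = (\<Prod>i\<in>UNIV. 2 * r * t ^ nat (\<gamma> $ i))"
    unfolding weighted_box_def by (subst content_cbox_cart) (auto intro!: prod.cong)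
  also have "\<dots> = (2 * r) ^ CARD('i) * (\<Prod>i\<in>UNIV. t powr \<gamma> $ i)"
    using assms(2,3) by (simp add: prod.distrib flip: powr_realpow)
  also have "(\<Prod>i\<in>UNIV. t powr \<gamma> $ i) = t powr mi_abs \<gamma>"
    using assms(2) by (simp add: mi_abs_def powr_sum)
  finally show ?thesis .
qed

lemma measure_weighted_box_Times:
  "measure lborel (weighted_box r t \<gamma> \<times> weighted_box r' t \<gamma>') =
     measure lborel (weighted_box r t \<gamma>) * measure lborel (weighted_box r' t \<gamma>')"
  unfolding weighted_box_def by (simp only: content_Pair flip: cbox_Pair_eq)

lemma weighted_box_Times_eq_cbox:
  obtains a b where "weighted_box r t \<gamma> \<times> weighted_box r' t \<gamma>' = cbox a b"
  unfolding weighted_box_def cbox_Pair_eq[symmetric] by blast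

section \<open>Lebesgue norms\<close>

text \<open>Reconciles the exponent \<open>enn2real (1 / p)\<close>, which is also meaningful at p =
  \<infinity>, with the exponent used by \<open>Lp_norm\<close> for finite p.\<close>

lemma enn2real_one_divide:
  assumes "1 \<le> p" and "p \<noteq> \<infinity>"
  shows "1 \<le> enn2real p" and "enn2real (1 / p) = 1 / enn2real p"
proof -
  obtain P where P: "p = ennreal P" "0 \<le> P"
    using assms(2) by (cases p rule: ennreal_cases) auto
  moreover have "1 \<le> P"
    using assms(1) P by (simp flip: ennreal_1)
  moreover have "1 / p = ennreal (1 / P)"
    using \<open>1 \<le> P\<close> P divide_ennreal[of 1 P] by simp
  ultimately show "1 \<le> enn2real p" "enn2real (1 / p) = 1 / enn2real p"
    by simp_all
qed

lemma Lp_indicator: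
  fixes A :: "'a::euclidean_space set"
  assumes "1 \<le> p" and A: "A \<in> sets lborel" "emeasure lborel A < \<infinity>" "0 < measure lborel A"
  shows in_Lp_indicator: "in_Lp p (indicator A)"
    and Lp_norm_indicator_le: "Lp_norm p (indicator A) \<le> measure lborel A powr enn2real (1 / p)"
proof -
  have meas: "(indicator A :: 'a \<Rightarrow> complex) \<in> borel_measurable lborel"
    using A(1) by simp
  have "in_Lp p (indicator A) \<and> Lp_norm p (indicator A) \<le> measure lborel A powr enn2real (1 / p)"
  proof (cases "p = \<infinity>")
    case True
    have "esssup lborel (\<lambda>x. ennreal (norm (indicator A x :: complex))) \<le> 1"
    proof (rule esssup_I)
      show "(\<lambda>x. ennreal (norm (indicator A x :: complex))) \<in> borel_measurable lborel"
        using meas by measurable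
    qed (simp add: indicator_def)
    then have "esssup lborel (\<lambda>x. ennreal (norm (indicator A x :: complex))) < \<infinity>"
      and "enn2real (esssup lborel (\<lambda>x. ennreal (norm (indicator A x :: complex)))) \<le> 1"
      by (auto intro: le_less_trans enn2real_leI)
    \<comment> \<open>The right-hand side is a power with exponent 0. It equals 1 because the
      measure is positive, whereas \<open>0 powr 0\<close> is 0.\<close>
    then show ?thesis
      using True meas A(3) by (simp add: in_Lp_def Lp_norm_def)
  next
    case False
    note P = enn2real_one_divide[OF assms(1) False]
    have eq: "norm (indicator A x :: complex) powr enn2real p = indicator A x" for x
      by (simp add: indicator_def)
    have "integrable lborel (indicator A :: 'a \<Rightarrow> real)"
      using A by (simp add: integrable_indicator_iff)
    then show ?thesis
      using False meas P by (simp add: in_Lp_def Lp_norm_def eq)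
  qed
  then show "in_Lp p (indicator A)" "Lp_norm p (indicator A) \<le> measure lborel A powr enn2real (1 / p)"
    by blast+
qed

text \<open>Chebyshev's argument for finite q; for q = \<infinity>, an essential supremum below c
  would make A a null set. Membership in \<open>L^q\<close> excludes the default value 0 of a
  divergent integral or of \<open>enn2real\<close> at \<infinity>.\<close>

lemma Lp_norm_ge:
  fixes A :: "'a::euclidean_space set"
  assumes "1 \<le> q" and g: "in_Lp q g" and A: "A \<in> sets lborel" "emeasure lborel A < \<infinity>" "0 < measure lborel A"
    and c: "0 \<le> c" "\<And>x. x \<in> A \<Longrightarrow> c \<le> norm (g x)"
  shows "c * measure lborel A powr enn2real (1 / q) \<le> Lp_norm q g"
proof (cases "q = \<infinity>")
  case True
  let ?s = "esssup lborel (\<lambda>x. ennreal (norm (g x)))"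
  have fin: "?s < \<infinity>"
    using g True by (simp add: in_Lp_def)
  have "ennreal c \<le> ?s"
  proof (rule ccontr)
    assume "\<not> ennreal c \<le> ?s"
    moreover have "AE x in lborel. ennreal (norm (g x)) \<le> ?s"
      by (rule esssup_AE)
    ultimately have "AE x in lborel. x \<notin> A"
      using c(2) by (auto elim!: eventually_mono simp: not_le) (meson ennreal_leI leD le_less_trans)
    then have "emeasure lborel A = 0"
      using A(1) by (simp add: AE_iff_measurable[OF _ refl] Collect_mem_eq)
    then show False
      using A(3) by (simp add: measure_def)
  qed
  then have "c \<le> enn2real ?s"
    using fin c(1) enn2real_mono by fastforce
  then show ?thesis
    using True A(3) by (simp add: Lp_norm_def)
next
  case False
  note Q = enn2real_one_divide[OF assms(1) False]
  let ?Q = "enn2real q"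
  have "c powr ?Q * measure lborel A = (\<integral>x. c powr ?Q * indicator A x \<partial>lborel)"
    by simp
  also have "\<dots> \<le> (\<integral>x. norm (g x) powr ?Q \<partial>lborel)"
  proof (rule integral_mono)
    show "integrable lborel (\<lambda>x. c powr ?Q * indicator A x)"
      using A by (simp add: integrable_indicator_iff)
    show "integrable lborel (\<lambda>x. norm (g x) powr ?Q)"
      using g False by (simp add: in_Lp_def)
    show "c powr ?Q * indicator A x \<le> norm (g x) powr ?Q" for x
      using c Q by (auto simp: indicator_def intro!: powr_mono2)
  qed
  finally have "(c powr ?Q * measure lborel A) powr (1 / ?Q) \<le> Lp_norm q g"
    using False Q by (auto simp: Lp_norm_def intro!: powr_mono2)
  then show ?thesis
    using c(1) Q A(3) by (simp add: powr_mult powr_powr)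
qed

text \<open>Replacing g by the constant c on K changes the integral by at most d times the measure
  of K, so oscillation cannot cancel more than that.\<close>

lemma norm_integral_ge:
  fixes g :: "'a::euclidean_space \<Rightarrow> complex"
  assumes "compact K" and "continuous_on K g" and "\<And>y. y \<in> K \<Longrightarrow> norm (g y - c) \<le> d"
  shows "(norm c - d) * measure lborel K \<le> norm (\<integral>y. indicator K y *\<^sub>R g y \<partial>lborel)"
proof -
  have g: "integrable lborel (\<lambda>y. indicator K y *\<^sub>R g y)"
    using assms by (intro borel_integrable_compact)
  have K: "integrable lborel (indicator K :: 'a \<Rightarrow> real)"
    using assms(1) using emeasure_compact_finite[of K] by (simp add: integrable_indicator_iff borel_compact)
  then have cK: "integrable lborel (\<lambda>y. indicator K y *\<^sub>R c)"
    by simp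
  have "norm ((\<integral>y. indicator K y *\<^sub>R g y \<partial>lborel) - (\<integral>y. indicator K y *\<^sub>R c \<partial>lborel))
      = norm (\<integral>y. indicator K y *\<^sub>R g y - indicator K y *\<^sub>R c \<partial>lborel)"
    using g cK by simp
  also have "\<dots> \<le> (\<integral>y. indicator K y * d \<partial>lborel)"
  proof (rule Bochner_Integration.integral_norm_bound_integral)
    show "integrable lborel (\<lambda>y. indicator K y *\<^sub>R g y - indicator K y *\<^sub>R c)"
      using g cK by (rule Bochner_Integration.integrable_diff)
    show "integrable lborel (\<lambda>y. indicator K y * d)"
      using K by simp
    show "norm (indicator K y *\<^sub>R g y - indicator K y *\<^sub>R c) \<le> indicator K y * d" for y
      using assms(3)[of y] by (cases "y \<in> K") simp_all
  qed
  also have "\<dots> = d * measure lborel K"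
    using K by simp
  finally have "norm ((\<integral>y. indicator K y *\<^sub>R g y \<partial>lborel) - measure lborel K *\<^sub>R c) \<le> d * measure lborel K"
    using K by simp
  moreover have "norm (measure lborel K *\<^sub>R c) = norm c * measure lborel K"
    by simp
  ultimately show ?thesis
    using norm_triangle_sub[of "measure lborel K *\<^sub>R c" "\<integral>y. indicator K y *\<^sub>R g y \<partial>lborel"]
    by (simp only: left_diff_distrib norm_minus_commute)
qed

section \<open>The model example\<close>

definition cube :: "real \<Rightarrow> ((real^'m) \<times> (real^'k) \<times> (real^'l)) set" where
  "cube r = {(x, y, z). (\<forall>i. \<bar>x $ i\<bar> \<le> r) \<and> (\<forall>i. \<bar>y $ i\<bar> \<le> r) \<and> (\<forall>i. \<bar>z $ i\<bar> \<le> r)}"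

lemma compact_cube: "compact (cube r :: ((real^'m) \<times> (real^'k) \<times> (real^'l)) set)"
proof -
  have "(cube r :: ((real^'m) \<times> (real^'k) \<times> (real^'l)) set) =
      cbox (\<chi> i. - r) (\<chi> i. r) \<times> cbox (\<chi> i. - r) (\<chi> i. r) \<times> cbox (\<chi> i. - r) (\<chi> i. r)"
    unfolding cube_def by (auto simp: mem_box_cart abs_le_iff minus_le_iff)
  then show ?thesis
    by (simp add: compact_Times compact_cbox)
qed

lemma cube_subset_open:
  fixes V :: "((real^'m) \<times> (real^'k) \<times> (real^'l)) set"
  assumes "open V" and "0 \<in> V"
  obtains r where "0 < r" "cube r \<subseteq> V"
proof -
  obtain e where e: "0 < e" "ball 0 e \<subseteq> V"
    using assms open_contains_ball by blast
  let ?N = "real (CARD('m) + CARD('k) + CARD('l))"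
  \<comment> \<open>The Euclidean norm is at most the sum of the N absolute coordinates, hence at
    most N r, which is below e.\<close>
  define r where "r = e / (?N + 1)"
  have N: "0 < ?N + 1" by simp
  show thesis
  proof
    show "0 < r" using e(1) N by (simp add: r_def)
    show "cube r \<subseteq> V"
    proof clarify
      fix x :: "real^'m" and y :: "real^'k" and z :: "real^'l"
      assume "(x, y, z) \<in> cube r"
      then have xyz: "\<And>i. \<bar>x $ i\<bar> \<le> r" "\<And>i. \<bar>y $ i\<bar> \<le> r" "\<And>i. \<bar>z $ i\<bar> \<le> r"
        by (auto simp: cube_def)
      have "norm (x, y, z) \<le> norm x + (norm y + norm z)"
        using norm_Pair_le[of x "(y, z)"] norm_Pair_le[of y z] by simp
      also have "\<dots> \<le> ?N * r"
        using norm_le_l1_cart[of x] sum_bounded_above[of UNIV "\<lambda>i. \<bar>x $ i\<bar>" r] xyz(1)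
          norm_le_l1_cart[of y] sum_bounded_above[of UNIV "\<lambda>i. \<bar>y $ i\<bar>" r] xyz(2)
          norm_le_l1_cart[of z] sum_bounded_above[of UNIV "\<lambda>i. \<bar>z $ i\<bar>" r] xyz(3)
        by (simp add: distrib_right)
      also have "\<dots> < e"
        using e(1) N by (simp add: r_def field_simps)
      finally show "(x, y, z) \<in> V"
        using e(2) by auto
    qed
  qed
qed

definition triple_scaling ::
  "real \<Rightarrow> int^'m \<Rightarrow> int^'k \<Rightarrow> int^'l \<Rightarrow> (real^'m) \<times> (real^'k) \<times> (real^'l) \<Rightarrow> (real^'m) \<times> (real^'k) \<times> (real^'l)"
where
  "triple_scaling t \<alpha>' \<alpha>'' \<beta>' = (\<lambda>(x', x'', y'). (scaling t \<alpha>' x', scaling t \<alpha>'' x'', scaling t \<beta>' y'))"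

lemma triple_scaling_in_cube:
  assumes "0 \<le> t" and "t \<le> 1" and "z \<in> cube r"
  shows "triple_scaling t \<alpha>' \<alpha>'' \<beta>' z \<in> cube r"
  using assms by (auto simp: triple_scaling_def cube_def intro: abs_scaling_le)

lemma bounded_derivs_triple_scaling:
  "bounded_derivs n (cube r) (\<lambda>t z. triple_scaling t \<alpha>' \<alpha>'' \<beta>' z)"
  unfolding triple_scaling_def case_prod_beta'
  by (intro bounded_derivs_Pair bounded_derivs_scaling[where r = r]) (auto simp: cube_def)

text \<open>Convergence bounds the dilated sequence at each point, which is decay of order
  \<beta>''_i along t = 2 ^ -j. The Taylor argument, applied to each component with its own order,
  makes this uniform over the cube and over all t in (0, 1].\<close>

lemma homogeneous_bound:
  fixes S :: "(real^'m) \<times> (real^'k) \<times> (real^'m) \<Rightarrow> real^'k"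
  assumes S: "smooth_on U S" and cube: "cube r \<subseteq> U \<inter> W"
    and nonneg: "\<And>i. 0 \<le> \<alpha>' $ i" "\<And>i. 0 \<le> \<alpha>'' $ i" "\<And>i. 0 \<le> \<beta>' $ i" "\<And>i. 0 \<le> \<beta>'' $ i"
    and conv: "\<And>x' x'' y'. (x', x'', y') \<in> W \<Longrightarrow>
      convergent (\<lambda>j. dil (int j) \<beta>''
        (S (dil (- int j) \<alpha>' x', dil (- int j) \<alpha>'' x'', dil (- int j) \<beta>' y')))"
  obtains M where "0 \<le> M"
    "\<And>t z i. 0 < t \<Longrightarrow> t \<le> 1 \<Longrightarrow> z \<in> cube r \<Longrightarrow>
       \<bar>S (triple_scaling t \<alpha>' \<alpha>'' \<beta>' z) $ i\<bar> \<le> M * t ^ nat (\<beta>'' $ i)"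
proof -
  let ?Q = "cube r :: ((real^'m) \<times> (real^'k) \<times> (real^'m)) set"
  define \<delta> where "\<delta> t z = triple_scaling t \<alpha>' \<alpha>'' \<beta>' z" for t z
  have "\<exists>M. \<forall>t\<in>{0..1}. \<forall>z\<in>?Q. \<bar>S (\<delta> t z) $ i\<bar> \<le> M * t ^ nat (\<beta>'' $ i)" for i
  proof -
    have "bounded_derivs (nat (\<beta>'' $ i)) ?Q (\<lambda>t z. S (\<delta> t z))"
    \<comment> \<open>The cube contains its own dilates, so it serves both as parameter set and as
      compact range of the curves.\<close>
    proof (rule bounded_derivs_compose[where K = ?Q])
      show "C_on (nat (\<beta>'' $ i)) U S"
        using S by (simp add: smooth_on_def)
      show "bounded_derivs (nat (\<beta>'' $ i)) ?Q \<delta>"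
        unfolding \<delta>_def by (rule bounded_derivs_triple_scaling)
      show "\<delta> t z \<in> ?Q" if "t \<in> {0..1}" "z \<in> ?Q" for t z
        using that by (simp add: \<delta>_def triple_scaling_in_cube)
    qed (use cube compact_cube in auto)
    then have "bounded_derivs (nat (\<beta>'' $ i)) ?Q (\<lambda>t z. S (\<delta> t z) $ i)"
      by (intro bounded_derivs_linear[OF bounded_linear_vec_nth])
    moreover have "\<exists>C. \<forall>j. \<bar>S (\<delta> ((1/2) ^ j) z) $ i\<bar> \<le> C * ((1/2) ^ j) ^ nat (\<beta>'' $ i)"
      if "z \<in> ?Q" for z
    proof -
      obtain x' x'' y' where z: "z = (x', x'', y')"
        by (cases z)
      define F where "F j = dil (int j) \<beta>''
        (S (dil (- int j) \<alpha>' x', dil (- int j) \<alpha>'' x'', dil (- int j) \<beta>' y'))" for j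
      have "convergent F"
        unfolding F_def using that cube z by (intro conv) auto
      then obtain C where C: "\<And>j. norm (F j) \<le> C"
        using convergent_imp_Bseq BseqE by metis
      have "\<bar>S (\<delta> ((1/2) ^ j) z) $ i\<bar> \<le> C * ((1/2) ^ j) ^ nat (\<beta>'' $ i)" for j
      proof -
        have "F j $ i = 2 powi (int j * \<beta>'' $ i) * S (\<delta> ((1/2) ^ j) z) $ i"
          unfolding F_def \<delta>_def z by (simp add: triple_scaling_def dil_neg_eq_scaling nonneg) (simp add: dil_def)
        also have "2 powi (int j * \<beta>'' $ i) = (2::real) powi int (j * nat (\<beta>'' $ i))"
          using nonneg(4)[of i] by simp
        also have "\<dots> = 2 ^ (j * nat (\<beta>'' $ i))"
          by (simp only: power_int_of_nat)
        finally have "\<bar>S (\<delta> ((1/2) ^ j) z) $ i\<bar> * 2 ^ (j * nat (\<beta>'' $ i)) \<le> C"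
          using C[of j] component_le_norm_cart[of "F j" i] by (simp add: abs_mult mult.commute)
        then show ?thesis
          by (simp add: power_mult[symmetric] power_divide pos_le_divide_eq)
      qed
      then show ?thesis by blast
    qed
    ultimately show ?thesis
      by (rule pointwise_decay_imp_uniform) blast+
  qed
  then obtain M where M: "\<And>i t z. t \<in> {0..1} \<Longrightarrow> z \<in> ?Q \<Longrightarrow> \<bar>S (\<delta> t z) $ i\<bar> \<le> M i * t ^ nat (\<beta>'' $ i)"
    by metis
  show thesis
  proof
    \<comment> \<open>Summing the absolute values of the componentwise constants gives one
      nonnegative constant for all components.\<close>
    show "0 \<le> (\<Sum>i\<in>UNIV. \<bar>M i\<bar>)"
      by (simp add: sum_nonneg)
    fix t :: real and z i
    assume t: "0 < t" "t \<le> 1" and z: "z \<in> ?Q"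
    then have "\<bar>S (\<delta> t z) $ i\<bar> \<le> M i * t ^ nat (\<beta>'' $ i)"
      by (intro M) auto
    also have "M i \<le> (\<Sum>i\<in>UNIV. \<bar>M i\<bar>)"
      using member_le_sum[of i UNIV "\<lambda>i. \<bar>M i\<bar>"] by simp
    finally show "\<bar>S (triple_scaling t \<alpha>' \<alpha>'' \<beta>' z) $ i\<bar> \<le> (\<Sum>i\<in>UNIV. \<bar>M i\<bar>) * t ^ nat (\<beta>'' $ i)"
      using t by (simp add: \<delta>_def mult_right_mono)
  qed
qed

text \<open>The half-width factor r + M leaves room for x'' and S together, so the indicator equals
  1 for every y' in its first factor. There \<psi> stays within half its modulus at 0 of \<psi>(0),
  which rules out cancellation.\<close>

lemma radon_op_indicator_ge:
  fixes S :: "(real^'m) \<times> (real^'k) \<times> (real^'m) \<Rightarrow> real^'k"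
  assumes \<psi>: "continuous_on UNIV \<psi>" and t: "0 < t" "t \<le> 1"
    and nonneg: "\<And>i. 0 \<le> \<alpha>'' $ i" "\<And>i. \<alpha>'' $ i \<le> \<beta>'' $ i"
    and near: "\<And>z. z \<in> cube r \<Longrightarrow>
      norm (\<psi> (triple_scaling t \<alpha>' \<alpha>'' \<beta>' z) - \<psi> 0) \<le> norm (\<psi> 0) / 2"
    and bound: "\<And>z i. z \<in> cube r \<Longrightarrow>
      \<bar>S (triple_scaling t \<alpha>' \<alpha>'' \<beta>' z) $ i\<bar> \<le> M * t ^ nat (\<beta>'' $ i)"
    and x: "x \<in> weighted_box r t \<alpha>' \<times> weighted_box r t \<beta>''"
  shows "norm (\<psi> 0) / 2 * measure lborel (weighted_box r t \<beta>')
    \<le> norm (radon_op S \<psi> (indicator (weighted_box r t \<beta>' \<times> weighted_box (r + M) t \<beta>'')) x)"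
proof -
  obtain x' x'' where x_eq: "x = (x', x'')"
    by (cases x)
  obtain u where u: "x' = scaling t \<alpha>' u" "\<And>i. \<bar>u $ i\<bar> \<le> r"
    using weighted_box_eq_scaling[of x' r t \<alpha>'] x t x_eq by auto
  have x''_box: "\<bar>x'' $ i\<bar> \<le> r * t ^ nat (\<beta>'' $ i)" for i
    using x x_eq by (simp add: mem_weighted_box)
  \<comment> \<open>Because t \<le> 1 and \<alpha>'' \<le> \<beta>'', the \<beta>'' box lies in the
    \<alpha>'' box. This exhibits x'' as a scaled point, as the bound on S requires.\<close>
  have "x'' \<in> weighted_box r t \<alpha>''"
    unfolding mem_weighted_box
  proof
    fix i
    have "0 \<le> r"
      using u(2) abs_ge_zero order_trans by blast
    then have "r * t ^ nat (\<beta>'' $ i) \<le> r * t ^ nat (\<alpha>'' $ i)"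
      using t nonneg[of i] by (intro mult_left_mono power_decreasing) auto
    with x''_box[of i] show "\<bar>x'' $ i\<bar> \<le> r * t ^ nat (\<alpha>'' $ i)" by linarith
  qed
  then obtain v where v: "x'' = scaling t \<alpha>'' v" "\<And>i. \<bar>v $ i\<bar> \<le> r"
    using weighted_box_eq_scaling[of x'' r t \<alpha>''] t by auto
  let ?K = "weighted_box r t \<beta>'" and ?f = "indicator (weighted_box r t \<beta>' \<times> weighted_box (r + M) t \<beta>'') :: _ \<Rightarrow> complex"
  have scaled: "\<exists>z\<in>cube r. (x', x'', y') = triple_scaling t \<alpha>' \<alpha>'' \<beta>' z" if y': "y' \<in> ?K" for y'
  proof -
    obtain w where "y' = scaling t \<beta>' w" "\<And>i. \<bar>w $ i\<bar> \<le> r"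
      using weighted_box_eq_scaling[OF y'] t by metis
    then show ?thesis
      using u v by (intro bexI[of _ "(u, v, w)"]) (auto simp: triple_scaling_def cube_def)
  qed
  \<comment> \<open>Off the box both sides vanish; on it the second argument lands in the enlarged
    \<beta>'' box, so the integrand is just \<psi>.\<close>
  have "?f (y', x'' + S (x', x'', y')) * \<psi> (x', x'', y') = indicator ?K y' *\<^sub>R \<psi> (x', x'', y')" for y'
  proof (cases "y' \<in> ?K")
    case True
    then have "\<bar>S (x', x'', y') $ i\<bar> \<le> M * t ^ nat (\<beta>'' $ i)" for i
      using scaled bound by metis
    then have "\<bar>(x'' + S (x', x'', y')) $ i\<bar> \<le> (r + M) * t ^ nat (\<beta>'' $ i)" for i
      using x''_box[of i] abs_triangle_ineq[of "x'' $ i" "S (x', x'', y') $ i"]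
      by (fastforce simp: distrib_right intro: order_trans add_mono)
    then show ?thesis
      using True by (simp add: mem_weighted_box[of "x'' + S (x', x'', y')"])
  qed simp
  then have "radon_op S \<psi> ?f x = (\<integral>y'. indicator ?K y' *\<^sub>R \<psi> (x', x'', y') \<partial>lborel)"
    by (simp add: radon_op_def x_eq)
  moreover have "(norm (\<psi> 0) - norm (\<psi> 0) / 2) * measure lborel ?K
      \<le> norm (\<integral>y'. indicator ?K y' *\<^sub>R \<psi> (x', x'', y') \<partial>lborel)"
  proof (rule norm_integral_ge)
    show "compact ?K"
      by (simp add: weighted_box_def compact_cbox)
    show "continuous_on ?K (\<lambda>y'. \<psi> (x', x'', y'))"
      by (intro continuous_on_compose2[OF \<psi>] continuous_intros) simp
    show "norm (\<psi> (x', x'', y') - \<psi> 0) \<le> norm (\<psi> 0) / 2" if "y' \<in> ?K" for y'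
      using scaled[OF that] near by metis
  qed
  ultimately show ?thesis
    by simp
qed

theorem mainTheorem4:
  fixes U :: "((real^'m) \<times> (real^'k) \<times> (real^'m)) set"
    and S :: "(real^'m) \<times> (real^'k) \<times> (real^'m) \<Rightarrow> real^'k"
    and \<psi> :: "(real^'m) \<times> (real^'k) \<times> (real^'m) \<Rightarrow> complex"
    and \<alpha>' \<beta>' :: "int^'m" and \<alpha>'' \<beta>'' :: "int^'k"
    and p q :: ennreal
  assumes "open U" and "0 \<in> U" and "smooth_on U S"
    and "cutoff_in U \<psi>" and "\<psi> 0 \<noteq> 0"
    and "homogeneity_conditions U S \<alpha>' \<alpha>'' \<beta>' \<beta>''"
    and "1 \<le> p" and "1 \<le> q"
    and "of_int (mi_abs \<beta>' + mi_abs \<beta>'') * enn2real (1 / p)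
           - of_int (mi_abs \<alpha>' + mi_abs \<beta>'') * enn2real (1 / q) > of_int (mi_abs \<beta>')"
  shows "\<not> bounded_Lp_Lq p q (radon_op S \<psi>)"
proof
  assume "bounded_Lp_Lq p q (radon_op S \<psi>)"
  then obtain C where C: "\<And>f. in_Lp p f \<Longrightarrow>
      in_Lp q (radon_op S \<psi> f) \<and> Lp_norm q (radon_op S \<psi> f) \<le> C * Lp_norm p f"
    unfolding bounded_Lp_Lq_def by blast
  from assms(6) have nonneg: "\<And>i. 0 \<le> \<alpha>' $ i" "\<And>i. 0 \<le> \<alpha>'' $ i" "\<And>i. 0 \<le> \<beta>' $ i"
    and less: "\<And>i. \<alpha>'' $ i < \<beta>'' $ i"
    by (auto simp: homogeneity_conditions_def)
  have \<beta>''_nonneg: "0 \<le> \<beta>'' $ i" for i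
    using nonneg(2)[of i] less[of i] by linarith
  from assms(6) obtain W where W: "open W" "0 \<in> W"
    and conv: "\<And>x' x'' y'. (x', x'', y') \<in> W \<Longrightarrow>
      convergent (\<lambda>j. dil (int j) \<beta>''
        (S (dil (- int j) \<alpha>' x', dil (- int j) \<alpha>'' x'', dil (- int j) \<beta>' y')))"
    unfolding homogeneity_conditions_def convergent_def by blast
  have \<psi>: "continuous_on UNIV \<psi>"
    using assms(4) unfolding cutoff_in_def smooth_on_def by (metis C_on.simps(1))
  \<comment> \<open>A neighbourhood on which S is smooth, the dilated limit exists, and \<psi> is
    close to \<psi>(0); it contains 0 because \<psi>(0) is nonzero.\<close>
  define V where "V = U \<inter> W \<inter> {z. dist (\<psi> z) (\<psi> 0) < norm (\<psi> 0) / 2}"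
  have "open V"
    unfolding V_def using assms(1) W(1) \<psi>
    by (intro open_Int open_Collect_less continuous_intros) auto
  moreover have "0 \<in> V"
    using assms(2,5) W(2) by (simp add: V_def)
  ultimately obtain r where r: "0 < r" and cube: "cube r \<subseteq> V"
    using cube_subset_open by blast
  then have "cube r \<subseteq> U \<inter> W"
    by (auto simp: V_def)
  then obtain M where M: "0 \<le> M" "\<And>t z i. 0 < t \<Longrightarrow> t \<le> 1 \<Longrightarrow> z \<in> cube r \<Longrightarrow>
       \<bar>S (triple_scaling t \<alpha>' \<alpha>'' \<beta>' z) $ i\<bar> \<le> M * t ^ nat (\<beta>'' $ i)"
    using homogeneous_bound[OF assms(3) _ nonneg \<beta>''_nonneg conv] by blast
  define P where "P = enn2real (1 / p)"
  define R where "R = enn2real (1 / q)"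
  define a' where "a' = real_of_int (mi_abs \<alpha>')"
  define b' where "b' = real_of_int (mi_abs \<beta>')"
  define b'' where "b'' = real_of_int (mi_abs \<beta>'')"
  define A where "A = (2 * r) ^ CARD('m)"
  define B where "B = (2 * r) ^ CARD('k)"
  define B' where "B' = (2 * (r + M)) ^ CARD('k)"
  \<comment> \<open>The gap in the assumed exponent inequality.\<close>
  define e where "e = (b' + b'') * P - b' - (a' + b'') * R"
  have pos: "0 < A" "0 < B" "0 < B'"
    using r M(1) by (simp_all add: A_def B_def B'_def)
  have e: "0 < e"
    using assms(9) by (simp add: e_def a'_def b'_def b''_def P_def R_def)
  \<comment> \<open>\<open>K\<close> and \<open>K'\<close> collect the factors independent of t in
    the lower and upper bounds for the norm of T f. The modulus of C appears because the definition
    of boundedness does not fix its sign.\<close>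
  define K where "K = norm (\<psi> 0) / 2 * A * (A * B) powr R"
  define K' where "K' = \<bar>C\<bar> * (A * B') powr P"
  have "K \<le> K' * t powr e" if t: "0 < t" "t \<le> 1" for t
  proof -
    \<comment> \<open>\<open>?E\<close> carries the test function; on \<open>?D\<close> its image
      under T is bounded below.\<close>
    let ?E = "weighted_box r t \<beta>' \<times> weighted_box (r + M) t \<beta>''"
    let ?D = "weighted_box r t \<alpha>' \<times> weighted_box r t \<beta>''"
    have vol: "measure lborel (weighted_box r t \<beta>') = A * t powr b'"
      "measure lborel ?E = A * B' * t powr (b' + b'')"
      "measure lborel ?D = A * B * t powr (a' + b'')"
      using r M(1) t nonneg \<beta>''_nonneg
      by (simp_all add: measure_weighted_box measure_weighted_box_Times A_def B_def B'_def
          a'_def b'_def b''_def powr_add)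
    have boxes: "\<exists>a b. ?E = cbox a b" "\<exists>a b. ?D = cbox a b"
      using weighted_box_Times_eq_cbox by metis+
    have E: "?E \<in> sets lborel" "emeasure lborel ?E < \<infinity>"
      and D: "?D \<in> sets lborel" "emeasure lborel ?D < \<infinity>"
      using boxes emeasure_lborel_cbox_finite by force+
    have vol_pos: "0 < measure lborel ?E" "0 < measure lborel ?D"
      unfolding vol using pos t by simp_all
    have Tf: "in_Lp q (radon_op S \<psi> (indicator ?E))"
      and le: "Lp_norm q (radon_op S \<psi> (indicator ?E)) \<le> C * Lp_norm p (indicator ?E)"
      using C[OF in_Lp_indicator[OF assms(7) E vol_pos(1)]] by auto
    have "norm (\<psi> 0) / 2 * (A * t powr b') * measure lborel ?D powr R
        \<le> Lp_norm q (radon_op S \<psi> (indicator ?E))"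
      unfolding R_def
    proof (rule Lp_norm_ge[OF assms(8) Tf D vol_pos(2)])
      show "0 \<le> norm (\<psi> 0) / 2 * (A * t powr b')"
        using pos by simp
      show "norm (\<psi> 0) / 2 * (A * t powr b') \<le> norm (radon_op S \<psi> (indicator ?E) x)" if "x \<in> ?D" for x
        unfolding vol(1)[symmetric]
      proof (rule radon_op_indicator_ge[OF \<psi> t nonneg(2) less_imp_le[OF less] _ _ that])
        fix z :: "(real^'m) \<times> (real^'k) \<times> (real^'m)"
        assume "z \<in> cube r"
        then have "triple_scaling t \<alpha>' \<alpha>'' \<beta>' z \<in> V"
          using cube triple_scaling_in_cube t by (meson less_imp_le subsetD)
        then show "norm (\<psi> (triple_scaling t \<alpha>' \<alpha>'' \<beta>' z) - \<psi> 0) \<le> norm (\<psi> 0) / 2"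
          by (simp add: V_def dist_norm)
      qed (rule M(2)[OF t])
    qed
    also note le
    also have "C * Lp_norm p (indicator ?E) \<le> \<bar>C\<bar> * measure lborel ?E powr P"
    proof (rule mult_mono)
      show "Lp_norm p (indicator ?E) \<le> measure lborel ?E powr P"
        unfolding P_def by (rule Lp_norm_indicator_le[OF assms(7) E vol_pos(1)])
      show "0 \<le> Lp_norm p (indicator ?E)"
        by (simp add: Lp_norm_def)
    qed simp_all
    finally have "K * t powr (b' + (a' + b'') * R) \<le> K' * t powr ((b' + b'') * P)"
      unfolding vol K_def K'_def using pos by (simp add: powr_mult powr_powr powr_add distrib_left mult_ac)
    \<comment> \<open>Factoring out the power from the left-hand side leaves exactly t to the gap e,
      and the positive common factor cancels.\<close>
    also have "\<dots> = K' * t powr e * t powr (b' + (a' + b'') * R)"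
      by (simp add: e_def mult.assoc flip: powr_add)
    finally show ?thesis
      using t by simp
  qed
  \<comment> \<open>Letting t = 2 ^ -j tend to 0 with e > 0 forces \<open>K\<close> \<le> 0,
    although \<open>K\<close> is positive since \<psi>(0) is nonzero.\<close>
  moreover have "((\<lambda>j. K' * ((1/2) ^ j) powr e) \<longlongrightarrow> K' * 0 powr e) sequentially"
    using e by (intro tendsto_mult tendsto_const tendsto_powr' LIMSEQ_power_zero) auto
  ultimately have "K \<le> K' * 0 powr e"
    by (intro LIMSEQ_le_const) (auto simp: power_le_one)
  then show False
    using pos assms(5) by (simp add: K_def mult_le_0_iff)
qed

end
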